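(* Let $\sigma>0$ and let $\phi(z)=az+b$ where $a=\pm1$ and $b\in\mathbb{C}$. Then the composition operator $C_\phi$ on the Paley-Wiener space $B^2_\sigma$ is (1) always complex symmetric; (2) normal if and only if $a=1$ and $b\in\mathbb{C}$, or $a=-1$ and $b\in\mathbb{R}$; (3) self-adjoint if and only if $a=1$ and $b\in i\mathbb{R}$, or $a=-1$ and $b\in\mathbb{R}$; (4) unitary if and only if $b\in\mathbb{R}$. Moreover, $C_\phi$ is $J_a$-symmetric on $B^2_\sigma$, where $J_a$ is the conjugation on $B^2_\sigma$ defined by $(J_af)(z)=\overline{f(-a\overline{z})}$.
   Context: For $\sigma>0$, the Paley-Wiener space $B^2_\sigma$ is the Hilbert space of all entire functions of exponential type $\leq\sigma$ whose restrictions to $\mathbb{R}$ belong to $L^2(\mathbb{R})$, with norm $\|f\|^2=\int_{-\infty}^{\infty}|f(t)|^2\,dt$ (and corresponding inner product). The composition operator is $C_\phi f=f\circ\phi$, which is bounded on $B^2_\sigma$ for the symbols considered. A conjugation on a Hilbert space $\mathcal{H}$ is a conjugate-linear operator $J:\mathcal{H}\to\mathcal{H}$ such that $\langle Jf,Jg\rangle=\langle g,f\rangle$ for all $f,g\in\mathcal{H}$ and $J^2=I$. A bounded operator $T$ on $\mathcal{H}$ is $J$-symmetric if $JT=T^*J$, and it is complex symmetric if it is $J$-symmetric for some conjugation $J$ on $\mathcal{H}$. *)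

theory Defs
  imports "HOL-Complex_Analysis.Complex_Analysis"
begin

text \<open>
  A Hilbert space of complex-valued functions is given by its carrier \<open>H\<close> and its inner
  product \<open>ip\<close>, linear in the first argument.  Operators are total on the underlying function
  type; only their action on \<open>H\<close> is relevant, so all identities between operators are
  required on \<open>H\<close> only.
\<close>

definition norm_on :: "(('s \<Rightarrow> complex) \<Rightarrow> ('s \<Rightarrow> complex) \<Rightarrow> complex) \<Rightarrow> ('s \<Rightarrow> complex) \<Rightarrow> real"
  where "norm_on ip f = sqrt (Re (ip f f))"

definition bounded_operator_on ::
  "('s \<Rightarrow> complex) set \<Rightarrow> (('s \<Rightarrow> complex) \<Rightarrow> ('s \<Rightarrow> complex) \<Rightarrow> complex)
    \<Rightarrow> (('s \<Rightarrow> complex) \<Rightarrow> ('s \<Rightarrow> complex)) \<Rightarrow> bool"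
  where "bounded_operator_on H ip T \<longleftrightarrow>
    (\<forall>f\<in>H. T f \<in> H) \<and>
    (\<forall>f\<in>H. \<forall>g\<in>H. \<forall>c d. T (\<lambda>s. c * f s + d * g s) = (\<lambda>s. c * T f s + d * T g s)) \<and>
    (\<exists>K. \<forall>f\<in>H. norm_on ip (T f) \<le> K * norm_on ip f)"

text \<open>For a bounded \<open>T\<close> on a Hilbert space the vector below exists uniquely (Riesz).\<close>

definition adjoint_on ::
  "('s \<Rightarrow> complex) set \<Rightarrow> (('s \<Rightarrow> complex) \<Rightarrow> ('s \<Rightarrow> complex) \<Rightarrow> complex)
    \<Rightarrow> (('s \<Rightarrow> complex) \<Rightarrow> ('s \<Rightarrow> complex)) \<Rightarrow> ('s \<Rightarrow> complex) \<Rightarrow> ('s \<Rightarrow> complex)"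
  where "adjoint_on H ip T g = (THE h. h \<in> H \<and> (\<forall>f\<in>H. ip (T f) g = ip f h))"

definition normal_on ::
  "('s \<Rightarrow> complex) set \<Rightarrow> (('s \<Rightarrow> complex) \<Rightarrow> ('s \<Rightarrow> complex) \<Rightarrow> complex)
    \<Rightarrow> (('s \<Rightarrow> complex) \<Rightarrow> ('s \<Rightarrow> complex)) \<Rightarrow> bool"
  where "normal_on H ip T \<longleftrightarrow> bounded_operator_on H ip T \<and>
    (\<forall>f\<in>H. T (adjoint_on H ip T f) = adjoint_on H ip T (T f))"

definition self_adjoint_on ::
  "('s \<Rightarrow> complex) set \<Rightarrow> (('s \<Rightarrow> complex) \<Rightarrow> ('s \<Rightarrow> complex) \<Rightarrow> complex)
    \<Rightarrow> (('s \<Rightarrow> complex) \<Rightarrow> ('s \<Rightarrow> complex)) \<Rightarrow> bool"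
  where "self_adjoint_on H ip T \<longleftrightarrow> bounded_operator_on H ip T \<and>
    (\<forall>f\<in>H. adjoint_on H ip T f = T f)"

definition unitary_on ::
  "('s \<Rightarrow> complex) set \<Rightarrow> (('s \<Rightarrow> complex) \<Rightarrow> ('s \<Rightarrow> complex) \<Rightarrow> complex)
    \<Rightarrow> (('s \<Rightarrow> complex) \<Rightarrow> ('s \<Rightarrow> complex)) \<Rightarrow> bool"
  where "unitary_on H ip T \<longleftrightarrow> bounded_operator_on H ip T \<and>
    (\<forall>f\<in>H. T (adjoint_on H ip T f) = f \<and> adjoint_on H ip T (T f) = f)"

definition conjugation_on ::
  "('s \<Rightarrow> complex) set \<Rightarrow> (('s \<Rightarrow> complex) \<Rightarrow> ('s \<Rightarrow> complex) \<Rightarrow> complex)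
    \<Rightarrow> (('s \<Rightarrow> complex) \<Rightarrow> ('s \<Rightarrow> complex)) \<Rightarrow> bool"
  where "conjugation_on H ip J \<longleftrightarrow>
    (\<forall>f\<in>H. J f \<in> H) \<and>
    (\<forall>f\<in>H. \<forall>g\<in>H. \<forall>c d. J (\<lambda>s. c * f s + d * g s) = (\<lambda>s. cnj c * J f s + cnj d * J g s)) \<and>
    (\<forall>f\<in>H. \<forall>g\<in>H. ip (J f) (J g) = ip g f) \<and>
    (\<forall>f\<in>H. J (J f) = f)"

definition J_symmetric_on ::
  "('s \<Rightarrow> complex) set \<Rightarrow> (('s \<Rightarrow> complex) \<Rightarrow> ('s \<Rightarrow> complex) \<Rightarrow> complex)
    \<Rightarrow> (('s \<Rightarrow> complex) \<Rightarrow> ('s \<Rightarrow> complex)) \<Rightarrow> (('s \<Rightarrow> complex) \<Rightarrow> ('s \<Rightarrow> complex)) \<Rightarrow> bool"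
  where "J_symmetric_on H ip J T \<longleftrightarrow> bounded_operator_on H ip T \<and>
    (\<forall>f\<in>H. J (T f) = adjoint_on H ip T (J f))"

definition complex_symmetric_on ::
  "('s \<Rightarrow> complex) set \<Rightarrow> (('s \<Rightarrow> complex) \<Rightarrow> ('s \<Rightarrow> complex) \<Rightarrow> complex)
    \<Rightarrow> (('s \<Rightarrow> complex) \<Rightarrow> ('s \<Rightarrow> complex)) \<Rightarrow> bool"
  where "complex_symmetric_on H ip T \<longleftrightarrow> (\<exists>J. conjugation_on H ip J \<and> J_symmetric_on H ip J T)"

text \<open>Equivalent to \<open>limsup\<close> of \<open>ln |f z| / |z|\<close>, as \<open>|z|\<close> tends to infinity, being at most \<open>\<sigma>\<close>.\<close>

definition exponential_type_le :: "(complex \<Rightarrow> complex) \<Rightarrow> real \<Rightarrow> bool"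
  where "exponential_type_le f \<sigma> \<longleftrightarrow>
    (\<forall>\<epsilon>>0. \<exists>C. \<forall>z. norm (f z) \<le> C * exp ((\<sigma> + \<epsilon>) * norm z))"

definition paley_wiener :: "real \<Rightarrow> (complex \<Rightarrow> complex) set"
  where "paley_wiener \<sigma> = {f. f holomorphic_on UNIV \<and> exponential_type_le f \<sigma> \<and>
    integrable lborel (\<lambda>t::real. (norm (f (of_real t)))\<^sup>2)}"

definition paley_wiener_inner :: "(complex \<Rightarrow> complex) \<Rightarrow> (complex \<Rightarrow> complex) \<Rightarrow> complex"
  where "paley_wiener_inner f g = (LINT t|lborel. f (of_real t) * cnj (g (of_real t)))"

definition composition_operator :: "('s \<Rightarrow> 's) \<Rightarrow> ('s \<Rightarrow> complex) \<Rightarrow> ('s \<Rightarrow> complex)"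
  where "composition_operator \<phi> f = f \<circ> \<phi>"

definition paley_wiener_conj :: "complex \<Rightarrow> (complex \<Rightarrow> complex) \<Rightarrow> (complex \<Rightarrow> complex)"
  where "paley_wiener_conj a f = (\<lambda>z. cnj (f (- a * cnj z)))"

end

theory Submission
  imports Defs "HOL-Probability.Sinc_Integral" "HOL-Real_Asymp.Real_Asymp"
begin

text \<open>
Write \<open>\<phi> z = a * z + b\<close> with \<open>a = 1\<close> or \<open>a = -1\<close>. Everything rests on one formula: on the
Paley-Wiener space the adjoint of composition with \<open>\<phi>\<close> is composition with
\<open>a * z - a * cnj b\<close> (\<open>adjoint_composition_affine\<close>). Given this, the operator and its adjoint
multiply like affine maps, and normality, self-adjointness and unitarity each become an equation in
\<open>a\<close> and \<open>b\<close>, while symmetry with respect to \<open>paley_wiener_conj a\<close> is an identity of symbols. Necessity of the equations needs only that the space contains a function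
without periods, for which \<open>sin (\<sigma> * z) / z\<close> serves (\<open>translations_eq_on_paley_wiener\<close>).

The analytic content is that translation by a complex number \<open>b\<close> is a bounded operator whose adjoint
is translation by \<open>- cnj b\<close>. Boundedness is the Plancherel-Polya inequality (\<open>plancherel_polya\<close>):
the \<open>L\<^sup>2\<close> norm of \<open>f\<close> along the line of height \<open>y\<close> is at most \<open>exp (\<sigma> * \<bar>y\<bar>)\<close> times the norm along the
real axis. It follows by duality from its pointwise analogue, the Phragmen-Lindelof bound
\<open>norm (G z) \<le> M * exp (\<sigma> * \<bar>Im z\<bar>)\<close> for an entire function \<open>G\<close> of exponential type at most
\<open>\<sigma>\<close> with \<open>norm G \<le> M\<close> on the real axis (\<open>phragmen_lindelof_exponential_type\<close>). The adjoint formula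
(\<open>paley_wiener_inner_shift\<close>) holds because the inner product of suitably coupled translates of
\<open>f\<close> and \<open>g\<close> depends holomorphically on the translation, and does not change under real translations.
\<close>

section \<open>Phragmen-Lindelof bounds\<close>

lemma entire_affine:
  fixes f :: "complex \<Rightarrow> complex"
  assumes "f holomorphic_on UNIV"
  shows "(\<lambda>z. f (a * z + b)) holomorphic_on UNIV"
  using holomorphic_on_compose_gen[of "\<lambda>z. a * z + b" UNIV f UNIV] assms
  by (simp add: o_def holomorphic_intros)

text \<open>
Intersecting \<open>D\<close> with a large disc gives a bounded region whose frontier lies partly on
\<open>frontier D\<close> and partly on the circle. This is the form in which the maximum principle is
used below, with \<open>v\<close> made small at infinity by a mollifying factor.
\<close>

lemma maximum_modulus_unbounded:
  assumes "closed D" and hol: "v holomorphic_on D"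
    and bd: "\<And>z. z \<in> frontier D \<Longrightarrow> norm (v z) \<le> B"
    and far: "\<And>z. z \<in> D \<Longrightarrow> norm z \<ge> R \<Longrightarrow> norm (v z) \<le> B"
    and "z \<in> D"
  shows "norm (v z) \<le> B"
proof (cases "norm z \<ge> R")
  case False
  let ?S = "cball 0 R \<inter> D"
  show ?thesis
  proof (rule maximum_modulus_frontier[of v ?S])
    show "v holomorphic_on interior ?S"
      using hol interior_subset by (rule holomorphic_on_subset[OF _ subset_trans]) auto
    have "closed ?S" using assms(1) by blast
    then show "continuous_on (closure ?S) v"
      using hol by (auto intro: holomorphic_on_imp_continuous_on holomorphic_on_subset)
    show "bounded ?S" by (simp add: bounded_Int)
    show "z \<in> ?S" using False \<open>z \<in> D\<close> by auto
    fix x assume x: "x \<in> frontier ?S"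
    then have "x \<in> D" using \<open>closed ?S\<close> frontier_subset_closed by blast
    have "x \<in> sphere 0 R \<or> x \<in> frontier D"
      using x frontier_Int_subset[of "cball 0 R" D] frontier_cball[of "0::complex" R] by blast
    then show "norm (v x) \<le> B" using bd far[OF \<open>x \<in> D\<close>] by auto
  qed
qed (use far assms in auto)

text \<open>
Every mollifying factor below, and every excess over the exponential type, comes with a parameter
that is finally sent to zero.
\<close>

lemma le_by_vanishing_parameter:
  fixes h :: "real \<Rightarrow> real"
  assumes "\<And>d. d > 0 \<Longrightarrow> x \<le> h d" and "isCont h 0"
  shows "x \<le> h 0"
proof (rule tendsto_lowerbound)
  show "(h \<longlongrightarrow> h 0) (at_right 0)"
    using assms(2) by (auto simp: continuous_at intro: tendsto_within_subset)
  show "eventually (\<lambda>d. x \<le> h d) (at_right 0)"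
    using assms(1) by (auto simp: eventually_at_filter)
qed auto

text \<open>
Exponential growth is of order 1, less than the order 2 that a quadrant tolerates. An intermediate
order is 3/2: the factor \<open>exp (- d * w powr (3/2))\<close> beats the growth of \<open>u\<close> and has modulus at
most 1, since the argument of \<open>w powr (3/2)\<close> stays within \<open>3 * pi / 8 < pi / 2\<close>.
\<close>

lemma phragmen_lindelof_quadrant:
  assumes hol: "u holomorphic_on UNIV"
    and growth: "\<And>z. norm (u z) \<le> C * exp (c * norm z)"
    and real: "\<And>x. x \<ge> 0 \<Longrightarrow> norm (u (of_real x)) \<le> B"
    and imag: "\<And>y. y \<ge> 0 \<Longrightarrow> norm (u (\<i> * of_real y)) \<le> B"
    and "B > 0" and z: "Re z \<ge> 0" "Im z \<ge> 0"
  shows "norm (u z) \<le> B"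
proof -
  \<comment> \<open>Multiplication by 1 - i turns the quadrant into the sector |arg| \<le> pi / 4 about the
      positive axis; the shift by 1 keeps w off the branch point of the power.\<close>
  define w where "w z = 1 + (1 - \<i>) * z" for z
  define p where "p z = w z powr (3/2)" for z
  define \<kappa> where "\<kappa> = cos (3/8 * pi)"
  let ?D = "{z. Re z \<ge> 0} \<inter> {z. Im z \<ge> 0}"
  have "\<kappa> > 0" unfolding \<kappa>_def by (rule cos_gt_zero_pi) auto
  have closed: "closed ?D" by (intro closed_Int closed_halfspace_Re_ge closed_halfspace_Im_ge)
  have Re_w: "Re (w z) = 1 + Re z + Im z" and Im_w: "Im (w z) = Im z - Re z" for z
    by (simp_all add: w_def)
  have Re_p: "Re (p z) \<ge> \<kappa> * norm z powr (3/2)" if "z \<in> ?D" for z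
  proof -
    have pos: "Re (w z) > 0" and "w z \<noteq> 0" using that by (auto simp: Re_w complex_eq_iff)
    have "\<bar>Im (w z)\<bar> \<le> Re (w z)" using that by (auto simp: Re_w Im_w)
    then have "\<bar>Im (Ln (w z))\<bar> \<le> pi / 4"
      using pos \<open>w z \<noteq> 0\<close>
      by (simp add: arg_conv_arctan abs_arctan abs_divide arctan_le_iff flip: arctan_one Arg_eq_Im_Ln)
    then have "\<kappa> \<le> cos (3/2 * Im (Ln (w z)))"
      unfolding \<kappa>_def by (subst (2) cos_abs_real[symmetric]) (rule cos_monotone_0_pi_le, auto)
    moreover have "norm z \<le> norm (w z)"
      using cmod_le[of z] complex_Re_le_cmod[of "w z"] that by (auto simp: Re_w)
    moreover have "Re (p z) = norm (w z) powr (3/2) * cos (3/2 * Im (Ln (w z)))"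
      using \<open>w z \<noteq> 0\<close> by (simp add: p_def powr_def Re_exp)
    ultimately show ?thesis
      using \<open>\<kappa> > 0\<close> by (smt (verit) mult.commute mult_mono powr_mono2 norm_ge_zero powr_ge_zero divide_nonneg_nonneg)
  qed
  have p_hol: "p holomorphic_on ?D"
  proof -
    have "w z \<notin> \<real>\<^sub>\<le>\<^sub>0" if "z \<in> ?D" for z
      using that by (auto simp: complex_nonpos_Reals_iff Re_w)
    then show ?thesis unfolding p_def[abs_def] 
      by (intro holomorphic_intros) (auto simp: w_def[abs_def] intro!: holomorphic_intros)
  qed
  have frontier: "(\<exists>x\<ge>0. z = of_real x) \<or> (\<exists>y\<ge>0. z = \<i> * of_real y)" if "z \<in> frontier ?D" for z
  proof -
    have "z \<in> ?D" using that closed frontier_subset_closed by blast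
    moreover have "z \<notin> {z. Re z > 0} \<inter> {z. Im z > 0}"
    proof
      assume *: "z \<in> {z. Re z > 0} \<inter> {z. Im z > 0}"
      have "open ({z. Re z > 0} \<inter> {z. Im z > 0})"
        by (intro open_Int open_halfspace_Re_gt open_halfspace_Im_gt)
      then have "z \<in> interior ?D" using * by (rule interiorI) auto
      then show False using that by (simp add: frontier_def)
    qed
    ultimately have "(Re z \<ge> 0 \<and> Im z = 0) \<or> (Im z \<ge> 0 \<and> Re z = 0)" by auto
    then show ?thesis 
      by (elim disjE) (auto simp: complex_eq_iff)
  qed
  have "norm (u z) \<le> B * exp (d * Re (p z))" if "d > 0" for d
  proof -
    define v where "v z = u z * exp (- of_real d * p z)" for z
    have norm_v: "norm (v z) = norm (u z) * exp (- d * Re (p z))" for z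
      by (simp add: v_def norm_mult)
    define k where "k = d * \<kappa>"
    have "k > 0" using \<open>d > 0\<close> \<open>\<kappa> > 0\<close> by (simp add: k_def)
    have "((\<lambda>r. exp (c * r) * exp (- k * r powr (3/2))) \<longlongrightarrow> 0) at_top"
      using \<open>k > 0\<close> by (cases c "0::real" rule: linorder_cases) (simp_all, real_asymp+)
    from tendsto_mult_right_zero[OF this, of C]
    have "((\<lambda>r. C * exp (c * r) * exp (- d * \<kappa> * r powr (3/2))) \<longlongrightarrow> 0) at_top"
      by (simp add: k_def mult.assoc)
    then have "eventually (\<lambda>r. C * exp (c * r) * exp (- d * \<kappa> * r powr (3/2)) < B) at_top"
      using \<open>B > 0\<close> by (rule order_tendstoD)
    then obtain R where R: "\<And>r. r \<ge> R \<Longrightarrow> C * exp (c * r) * exp (- d * \<kappa> * r powr (3/2)) < B"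
      by (auto simp: eventually_at_top_linorder)
    have "norm (v z) \<le> B"
    proof (rule maximum_modulus_unbounded[of ?D v B R])
      show "v holomorphic_on ?D"
        unfolding v_def[abs_def] using hol
        by (intro holomorphic_intros p_hol) (auto intro: holomorphic_on_subset)
      show "norm (v z) \<le> B" if "z \<in> frontier ?D" for z
      proof -
        have "z \<in> ?D" using that closed frontier_subset_closed by blast
        then have "Re (p z) \<ge> 0"
          using Re_p[of z] \<open>\<kappa> > 0\<close> by (smt (verit) mult_nonneg_nonneg powr_ge_zero)
        then have "norm (v z) \<le> norm (u z)"
          using \<open>d > 0\<close> by (simp add: norm_v mult_left_le)
        then show ?thesis using frontier[OF that] real imag by force
      qed
      show "norm (v z) \<le> B" if "z \<in> ?D" "R \<le> norm z" for z
      proof -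
        have "norm (v z) \<le> C * exp (c * norm z) * exp (- d * \<kappa> * norm z powr (3/2))"
          unfolding norm_v using Re_p[OF that(1)] \<open>d > 0\<close> growth[of z]
          by (intro mult_mono) (auto simp: mult.assoc order_trans[OF norm_ge_zero growth])
        then show ?thesis using R[OF that(2)] by linarith
      qed
    qed (use z closed in auto)
    then show ?thesis by (simp add: norm_v exp_minus field_simps)
  qed
  then have "norm (u z) \<le> B * exp (0 * Re (p z))"
    by (rule le_by_vanishing_parameter) (auto intro!: continuous_intros)
  then show ?thesis by simp
qed

text \<open>
A function already known to be bounded needs only a mollifier that tends to 0 at infinity;
\<open>1 / (1 - \<i> * d * z)\<close> does, and has modulus at most 1 on the upper half-plane.
\<close>

lemma phragmen_lindelof_half_plane:
  assumes hol: "u holomorphic_on UNIV"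
    and bounded: "\<And>z. Im z \<ge> 0 \<Longrightarrow> norm (u z) \<le> K"
    and real: "\<And>x. norm (u (of_real x)) \<le> B"
    and "B > 0" and z: "Im z \<ge> 0"
  shows "norm (u z) \<le> B"
proof -
  let ?D = "{z. Im z \<ge> 0}"
  have closed: "closed ?D" by (rule closed_halfspace_Im_ge)
  have "norm (u z) \<le> B * norm (1 - \<i> * of_real d * z)" if "d > 0" for d
  proof -
    define q where "q z = 1 - \<i> * of_real d * z" for z
    have Re_q: "Re (q z) \<ge> 1" if "z \<in> ?D" for z
      using that \<open>d > 0\<close> by (simp add: q_def)
    then have q0: "q z \<noteq> 0" if "z \<in> ?D" for z
      using that by force
    have norm_q: "norm (q z) \<ge> 1" if "z \<in> ?D" for z
      using Re_q[OF that] complex_Re_le_cmod[of "q z"] by linarith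
    have "norm (u z / q z) \<le> B"
    proof (rule maximum_modulus_unbounded[of ?D "\<lambda>z. u z / q z" B "(\<bar>K\<bar> / B + 1) / d"])
      show "(\<lambda>z. u z / q z) holomorphic_on ?D"
        using hol q0 unfolding q_def by (intro holomorphic_intros) (auto intro: holomorphic_on_subset)
      show "norm (u z / q z) \<le> B" if "z \<in> frontier ?D" for z
      proof -
        have "z \<in> ?D" using that closed frontier_subset_closed by blast
        moreover have "z \<notin> {z. Im z > 0}"
          using that interior_maximal[OF _ open_halfspace_Im_gt[of 0], of ?D]
          by (force simp: frontier_def subset_iff)
        ultimately have "z = of_real (Re z)" by (auto simp: complex_eq_iff)
        then have "norm (u z) \<le> B" using real by metis
        then show ?thesis using norm_q[OF \<open>z \<in> ?D\<close>] \<open>B > 0\<close>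
          by (simp add: norm_divide divide_le_eq) (smt (verit) mult_le_cancel_left1)
      qed
      show "norm (u z / q z) \<le> B" if "z \<in> ?D" "(\<bar>K\<bar> / B + 1) / d \<le> norm z" for z
      proof -
        have "\<bar>K\<bar> / B + 1 \<le> d * norm z"
          using that(2) \<open>d > 0\<close> by (simp add: divide_le_eq mult.commute)
        also have "d * norm z = norm (1 - q z)" 
          using \<open>d > 0\<close> by (simp add: q_def norm_mult)
        also have "\<dots> \<le> 1 + norm (q z)" using norm_triangle_ineq4[of 1 "q z"] by simp
        finally have "\<bar>K\<bar> \<le> B * norm (q z)" using \<open>B > 0\<close> by (simp add: field_simps)
        then show ?thesis using bounded[of z] norm_q[of z] that(1) \<open>B > 0\<close>
          by (auto simp: norm_divide divide_le_eq)
      qed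
    qed (use z closed in auto)
    moreover have "norm (q z) > 0" using norm_q[of z] z by (simp del: zero_less_norm_iff)
    ultimately have "norm (u z) \<le> B * norm (q z)" by (simp add: norm_divide pos_divide_le_eq)
    then show ?thesis by (simp add: q_def)
  qed
  then have "norm (u z) \<le> B * norm (1 - \<i> * of_real 0 * z)"
    by (rule le_by_vanishing_parameter) (auto intro!: continuous_intros)
  then show ?thesis by simp
qed

text \<open>
The factor \<open>exp (\<i> * s * z)\<close> with \<open>s = \<sigma> + \<epsilon>\<close> has modulus 1 on the real axis and cancels the
exponential growth of \<open>G\<close> on the positive imaginary axis. The product is therefore bounded on the
boundary of both upper quadrants, hence on the upper half-plane, hence by its bound on the real axis.
\<close>

lemma phragmen_lindelof_upper:
  assumes hol: "G holomorphic_on UNIV" and type: "exponential_type_le G \<sigma>"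
    and real: "\<And>x. norm (G (of_real x)) \<le> M" and z: "Im z \<ge> 0"
  shows "norm (G z) \<le> M * exp (\<sigma> * Im z)"
proof -
  have "M \<ge> 0" using real[of 0] norm_ge_zero order_trans by blast
  have "norm (G z) \<le> (M + \<epsilon>) * exp ((\<sigma> + \<epsilon>) * Im z)" if "\<epsilon> > 0" for \<epsilon>
  proof -
    define s where "s = \<sigma> + \<epsilon>"
    define u where "u z = G z * exp (\<i> * of_real s * z)" for z
    have norm_u: "norm (u z) = norm (G z) * exp (- s * Im z)" for z
      by (simp add: u_def norm_mult)
    have u_hol: "u holomorphic_on UNIV"
      unfolding u_def[abs_def] by (intro holomorphic_intros hol)
    obtain C where C: "\<And>z. norm (G z) \<le> C * exp (s * norm z)"
      using type \<open>\<epsilon> > 0\<close> unfolding exponential_type_le_def s_def by blast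
    have growth: "norm (u z) \<le> C * exp ((s + \<bar>s\<bar>) * norm z)" for z
    proof -
      have "- s * Im z \<le> \<bar>s\<bar> * \<bar>Im z\<bar>" by (metis abs_ge_self abs_minus_cancel abs_mult)
      also have "\<dots> \<le> \<bar>s\<bar> * norm z" by (intro mult_left_mono abs_Im_le_cmod) auto
      finally have "norm (u z) \<le> (C * exp (s * norm z)) * exp (\<bar>s\<bar> * norm z)"
        unfolding norm_u using C[of z] 
        by (intro mult_mono) (auto simp: order_trans[OF norm_ge_zero C])
      then show ?thesis by (simp add: distrib_right exp_add)
    qed
    \<comment> \<open>The summand only makes the bound strictly positive.\<close>
    define B where "B = max C M + \<epsilon>"
    have "B > 0" using \<open>M \<ge> 0\<close> \<open>\<epsilon> > 0\<close> by (simp add: B_def max_def)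
    have u_real: "norm (u (of_real x)) \<le> M" for x using real by (simp add: norm_u)
    have u_real_B: "norm (u (of_real x)) \<le> B" for x
      using u_real[of x] \<open>\<epsilon> > 0\<close> by (simp add: B_def max_def)
    have "norm (u (\<i> * of_real y)) \<le> C" if "y \<ge> 0" for y
    proof -
      have "norm (u (\<i> * of_real y)) \<le> C * exp (s * y) * exp (- s * y)"
        unfolding norm_u using C[of "\<i> * of_real y"] that by (simp add: norm_mult)
      also have "\<dots> = C" by (simp add: mult.assoc flip: exp_add)
      finally show ?thesis .
    qed
    then have u_imag: "norm (u (\<i> * of_real y)) \<le> B" if "y \<ge> 0" for y
      using that \<open>\<epsilon> > 0\<close> by (fastforce simp: B_def)
    have bounded: "norm (u z) \<le> B" if "Im z \<ge> 0" for z
    proof (cases "Re z \<ge> 0")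
      case True
      then show ?thesis
        using phragmen_lindelof_quadrant[OF u_hol growth u_real_B u_imag \<open>B > 0\<close>] that by blast
    next
      case False
      \<comment> \<open>Rotation by a right angle carries the second quadrant to the first.\<close>
      have "norm (u (\<i> * (z / \<i>))) \<le> B"
      proof (rule phragmen_lindelof_quadrant[of "\<lambda>z. u (\<i> * z)" C "s + \<bar>s\<bar>"])
        show "(\<lambda>z. u (\<i> * z)) holomorphic_on UNIV"
          using entire_affine[OF u_hol, of \<i> 0] by simp
        show "norm (u (\<i> * z)) \<le> C * exp ((s + \<bar>s\<bar>) * norm z)" for z
          using growth[of "\<i> * z"] by (simp add: norm_mult)
        show "norm (u (\<i> * (\<i> * of_real y))) \<le> B" for y
          using u_real_B[of "- y"] by (simp add: mult.assoc[symmetric])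
      qed (use False that u_imag \<open>B > 0\<close> in \<open>auto simp: Re_divide Im_divide\<close>)
      then show ?thesis by simp
    qed
    have "norm (u z) \<le> M + \<epsilon>"
      using u_real \<open>M \<ge> 0\<close> \<open>\<epsilon> > 0\<close>
      by (intro phragmen_lindelof_half_plane[OF u_hol bounded _ _ z]) (auto intro: add_increasing2)
    then have "norm (G z) * exp (- s * Im z) * exp (s * Im z) \<le> (M + \<epsilon>) * exp (s * Im z)"
      unfolding norm_u by (rule mult_right_mono) simp
    then have "norm (G z) \<le> (M + \<epsilon>) * exp (s * Im z)" by (simp add: mult.assoc flip: exp_add)
    then show ?thesis by (simp add: s_def)
  qed
  then have "norm (G z) \<le> (M + 0) * exp ((\<sigma> + 0) * Im z)"
    by (rule le_by_vanishing_parameter) (auto intro!: continuous_intros)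
  then show ?thesis by simp
qed

lemma exponential_type_le_affine:
  assumes "exponential_type_le f \<sigma>" "norm a = 1" "\<sigma> \<ge> 0"
  shows "exponential_type_le (\<lambda>z. f (a * z + b)) \<sigma>"
  unfolding exponential_type_le_def
proof (intro allI impI)
  fix \<epsilon> :: real assume "\<epsilon> > 0"
  then obtain C where C: "\<And>z. norm (f z) \<le> C * exp ((\<sigma> + \<epsilon>) * norm z)"
    using assms(1) unfolding exponential_type_le_def by blast
  have "C \<ge> 0" using order_trans[OF norm_ge_zero C[of 0]] by simp
  have "norm (f (a * z + b)) \<le> C * exp ((\<sigma> + \<epsilon>) * norm b) * exp ((\<sigma> + \<epsilon>) * norm z)" for z
  proof -
    have "norm (a * z + b) \<le> norm b + norm z"
      using norm_triangle_ineq[of "a * z" b] assms(2) by (simp add: norm_mult)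
    then have "exp ((\<sigma> + \<epsilon>) * norm (a * z + b)) \<le> exp ((\<sigma> + \<epsilon>) * norm b) * exp ((\<sigma> + \<epsilon>) * norm z)"
      using \<open>\<epsilon> > 0\<close> \<open>\<sigma> \<ge> 0\<close> by (simp flip: exp_add distrib_left)
    then show ?thesis
      using C[of "a * z + b"] \<open>C \<ge> 0\<close> mult_left_mono by (fastforce simp: mult.assoc)
  qed
  then show "\<exists>C. \<forall>z. norm (f (a * z + b)) \<le> C * exp ((\<sigma> + \<epsilon>) * norm z)" by blast
qed

lemma phragmen_lindelof_exponential_type:
  assumes hol: "G holomorphic_on UNIV" and type: "exponential_type_le G \<sigma>" and "\<sigma> \<ge> 0"
    and real: "\<And>x. norm (G (of_real x)) \<le> M"
  shows "norm (G z) \<le> M * exp (\<sigma> * \<bar>Im z\<bar>)"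
proof (cases "Im z \<ge> 0")
  case False
  have "norm (G (- (- z))) \<le> M * exp (\<sigma> * Im (- z))"
  proof (rule phragmen_lindelof_upper[of "\<lambda>z. G (- z)"])
    show "(\<lambda>z. G (- z)) holomorphic_on UNIV"
      using entire_affine[OF hol, of "-1" 0] by simp
    show "exponential_type_le (\<lambda>z. G (- z)) \<sigma>"
      using exponential_type_le_affine[OF type, of "-1" 0] \<open>\<sigma> \<ge> 0\<close> by simp
    show "norm (G (- of_real x)) \<le> M" for x using real[of "- x"] by simp
  qed (use False in auto)
  then show ?thesis using False by simp
qed (use phragmen_lindelof_upper[OF assms(1,2,4)] in auto)

section \<open>The Plancherel-Polya inequality\<close>

lemma paley_wienerD:
  assumes "f \<in> paley_wiener \<sigma>"
  shows paley_wiener_holomorphic: "f holomorphic_on UNIV"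
    and paley_wiener_type: "exponential_type_le f \<sigma>"
    and paley_wiener_square_integrable: "integrable lborel (\<lambda>t::real. (norm (f (of_real t)))\<^sup>2)"
  using assms by (auto simp: paley_wiener_def)

lemma continuous_on_entire:
  fixes f :: "complex \<Rightarrow> complex"
  assumes "f holomorphic_on UNIV" "continuous_on S g"
  shows "continuous_on S (\<lambda>x. f (g x))"
  using continuous_on_compose2[OF holomorphic_on_imp_continuous_on[OF assms(1)] assms(2)] by auto

lemma integral_interval_eq_indicator:
  fixes g :: "real \<Rightarrow> 'a::euclidean_space"
  assumes "continuous_on UNIV g"
  shows "integrable lborel (\<lambda>t. indicator {a..b} t *\<^sub>R g t)"
    and "integral {a..b} g = (LINT t|lborel. indicator {a..b} t *\<^sub>R g t)"
proof -
  show *: "integrable lborel (\<lambda>t. indicator {a..b} t *\<^sub>R g t)"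
    using assms by (intro borel_integrable_compact) (auto intro: continuous_on_subset)
  then show "integral {a..b} g = (LINT t|lborel. indicator {a..b} t *\<^sub>R g t)"
    using set_borel_integral_eq_integral(2)[of "{a..b}" g]
    by (simp add: set_integrable_def set_lebesgue_integral_def)
qed

lemma integral_interval_le_lborel:
  fixes g :: "real \<Rightarrow> real"
  assumes "continuous_on UNIV g" "integrable lborel g" "\<And>t. g t \<ge> 0"
  shows "integral {a..b} g \<le> (LINT t|lborel. g t)"
  unfolding integral_interval_eq_indicator(2)[OF assms(1)]
  using assms by (intro integral_mono integral_interval_eq_indicator) (auto simp: indicator_def)

lemma indicator_intervals_tendsto:
  fixes g :: "real \<Rightarrow> 'a::real_normed_vector"
  shows "(\<lambda>n. indicator {- real n..real n} t *\<^sub>R g t) \<longlonglongrightarrow> g t"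
proof (rule tendsto_eventually)
  obtain N where "\<bar>t\<bar> \<le> real N" using real_arch_simple by blast
  then show "\<forall>\<^sub>F n in sequentially. indicator {- real n..real n} t *\<^sub>R g t = g t"
    by (intro eventually_sequentiallyI[of N]) (auto simp: indicator_def)
qed

lemma integrable_if_intervals_bounded:
  fixes g :: "real \<Rightarrow> real"
  assumes cont: "continuous_on UNIV g" and nonneg: "\<And>t. g t \<ge> 0"
    and le: "\<And>R. R \<ge> 0 \<Longrightarrow> integral {-R..R} g \<le> K"
  shows "integrable lborel g" and "(LINT t|lborel. g t) \<le> K"
proof -
  define I where "I n = integral {- real n..real n} g" for n
  have int: "g integrable_on {a..b}" for a b
    using cont by (intro integrable_continuous_interval) (auto intro: continuous_on_subset)
  have "incseq I"
    unfolding I_def using int nonneg by (intro incseq_SucI integral_subset_le) auto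
  then obtain L where L: "I \<longlonglongrightarrow> L" and "\<forall>n. I n \<le> L"
    using incseq_convergent[of I K] le unfolding I_def by auto
  have lim: "(\<lambda>n. indicator {- real n..real n} t *\<^sub>R g t) \<longlonglongrightarrow> g t" for t
    by (rule indicator_intervals_tendsto)
  have mono: "mono (\<lambda>n. indicator {- real n..real n} t *\<^sub>R g t)" for t
    using nonneg by (intro monoI) (auto simp: indicator_def)
  have L': "(\<lambda>n. LINT t|lborel. indicator {- real n..real n} t *\<^sub>R g t) \<longlonglongrightarrow> L"
    using L unfolding I_def integral_interval_eq_indicator(2)[OF cont] .
  have meas: "g \<in> borel_measurable lborel" using cont by (simp add: borel_measurable_continuous_onI)
  have pos: "0 \<le> indicator {- real n..real n} t *\<^sub>R g t" for n t
    using nonneg by (simp add: indicator_def)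
  note mct = integral_monotone_convergence_nonneg
    [OF integral_interval_eq_indicator(1)[OF cont] AE_I2[OF mono] AE_I2[OF pos] AE_I2[OF lim] L' meas]
  from mct show "integrable lborel g" and "(LINT t|lborel. g t) \<le> K"
    using LIMSEQ_le_const2[OF L, of K] le unfolding I_def by auto
qed

lemma holomorphic_convolution:
  fixes f :: "complex \<Rightarrow> complex" and h :: "real \<Rightarrow> complex"
  assumes "f holomorphic_on UNIV" "continuous_on {a..b} h"
  shows "(\<lambda>z. integral {a..b} (\<lambda>t. f (z + of_real t) * h t)) holomorphic_on UNIV"
  unfolding interval_cbox
proof (rule leibniz_rule_holomorphic)
  have deriv: "deriv f holomorphic_on UNIV"
    using assms(1) by (rule holomorphic_deriv) simp
  show "((\<lambda>z. f (z + of_real t) * h t) has_field_derivative deriv f (z + of_real t) * h t)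
          (at z within UNIV)" for z t
    using holomorphic_derivI[OF assms(1), of "z + of_real t" UNIV]
    by (intro DERIV_cmult_right) (simp add: DERIV_shift)
  show "(\<lambda>t. f (z + of_real t) * h t) integrable_on cbox a b" for z
    using assms unfolding interval_cbox[symmetric]
    by (intro integrable_continuous_interval continuous_intros continuous_on_entire[OF assms(1)])
  show "continuous_on (UNIV \<times> cbox a b) (\<lambda>(z, t). deriv f (z + of_real t) * h t)"
    unfolding case_prod_beta
    by (intro continuous_intros continuous_on_entire[OF deriv] continuous_on_compose2[OF assms(2)]) auto
qed simp

lemma exponential_type_le_convolution:
  fixes f :: "complex \<Rightarrow> complex" and h :: "real \<Rightarrow> complex"
  assumes "f holomorphic_on UNIV" and "exponential_type_le f \<sigma>" "\<sigma> \<ge> 0"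
    and "continuous_on {-R..R} h" "R \<ge> 0"
  shows "exponential_type_le (\<lambda>z. integral {-R..R} (\<lambda>t. f (z + of_real t) * h t)) \<sigma>"
  unfolding exponential_type_le_def
proof (intro allI impI)
  fix \<epsilon> :: real assume "\<epsilon> > 0"
  then obtain C where C: "\<And>z. norm (f z) \<le> C * exp ((\<sigma> + \<epsilon>) * norm z)"
    using assms(2) unfolding exponential_type_le_def by blast
  have "C \<ge> 0" using order_trans[OF norm_ge_zero C[of 0]] by simp
  have "bounded (h ` {-R..R})"
    using assms(4) compact_continuous_image compact_imp_bounded by blast
  then obtain H where "\<forall>t\<in>{-R..R}. norm (h t) \<le> H"
    by (auto simp: bounded_iff)
  then have H: "norm (h t) \<le> H" if "t \<in> {-R..R}" for t
    using that by blast
  have "norm (integral {-R..R} (\<lambda>t. f (z + of_real t) * h t))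
      \<le> (C * exp ((\<sigma> + \<epsilon>) * R) * H * (R - - R)) * exp ((\<sigma> + \<epsilon>) * norm z)" for z
  proof -
    have "norm (f (z + of_real t) * h t) \<le> C * exp ((\<sigma> + \<epsilon>) * (norm z + R)) * H"
      if t: "t \<in> {-R..R}" for t
    proof -
      have "norm (z + of_real t) \<le> norm z + R"
        using norm_triangle_ineq[of z "of_real t"] t by auto
      then have "C * exp ((\<sigma> + \<epsilon>) * norm (z + of_real t)) \<le> C * exp ((\<sigma> + \<epsilon>) * (norm z + R))"
        using \<open>\<epsilon> > 0\<close> \<open>\<sigma> \<ge> 0\<close> \<open>C \<ge> 0\<close> by (intro mult_left_mono) auto
      then show ?thesis
        using C[of "z + of_real t"] H[OF t] \<open>C \<ge> 0\<close> unfolding norm_mult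
        by (intro mult_mono) auto
    qed
    then have "norm (integral {-R..R} (\<lambda>t. f (z + of_real t) * h t))
        \<le> (C * exp ((\<sigma> + \<epsilon>) * (norm z + R)) * H) * (R - - R)"
      using assms(4,5)
      by (intro integral_bound continuous_intros continuous_on_entire[OF assms(1)]) auto
    then show ?thesis by (simp add: distrib_left exp_add mult_ac)
  qed
  then show "\<exists>C. \<forall>z. norm (integral {-R..R} (\<lambda>t. f (z + of_real t) * h t)) \<le> C * exp ((\<sigma> + \<epsilon>) * norm z)"
    by blast
qed

text \<open>
The \<open>L\<^sup>2\<close> bound is reduced to the pointwise bound of Phragmen and Lindelof by duality: pair the
translates of \<open>f\<close> with the restriction of \<open>f (w + t)\<close> to \<open>[-R, R]\<close>. The resulting function \<open>G\<close>
is entire of the same exponential type, its values on the real axis are controlled by the norms of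
\<open>f\<close> and of the restriction, and its value at \<open>w\<close> is the integral \<open>I\<close> to be estimated.
\<close>

lemma plancherel_polya_interval:
  assumes f: "f \<in> paley_wiener \<sigma>" and "\<sigma> \<ge> 0" "R \<ge> 0"
  shows "integral {-R..R} (\<lambda>t. (norm (f (w + of_real t)))\<^sup>2)
      \<le> exp (2 * \<sigma> * \<bar>Im w\<bar>) * (LINT t|lborel. (norm (f (of_real t)))\<^sup>2)"
proof -
  note hol = paley_wiener_holomorphic[OF f]
  define N where "N = (LINT t|lborel. (norm (f (of_real t)))\<^sup>2)"
  define I where "I = integral {-R..R} (\<lambda>t. (norm (f (w + of_real t)))\<^sup>2)"
  define e where "e = exp (\<sigma> * \<bar>Im w\<bar>)"
  define G where "G z = integral {-R..R} (\<lambda>t. f (z + of_real t) * cnj (f (w + of_real t)))" for z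
  have cont_h: "continuous_on {-R..R} (\<lambda>t. cnj (f (w + of_real t)))"
    by (intro continuous_intros continuous_on_entire[OF hol])
  have cont_sq: "continuous_on S (\<lambda>t. (norm (f (z + of_real t)))\<^sup>2)" for S z
    by (intro continuous_intros continuous_on_entire[OF hol])
  have int_sq: "(\<lambda>t. (norm (f (z + of_real t)))\<^sup>2) integrable_on {-R..R}" for z
    by (intro integrable_continuous_interval cont_sq)
  have "e > 0" by (simp add: e_def)
  have G_real: "norm (G (of_real x)) \<le> (e * N + I / e) / 2" for x
  proof -
    have "norm (G (of_real x)) \<le> integral {-R..R}
        (\<lambda>t. (e * (norm (f (of_real x + of_real t)))\<^sup>2 + (norm (f (w + of_real t)))\<^sup>2 / e) / 2)"
      unfolding G_def
    proof (rule Henstock_Kurzweil_Integration.integral_norm_bound_integral)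
      fix t
      let ?a = "norm (f (of_real x + of_real t))" and ?b = "norm (f (w + of_real t))"
      \<comment> \<open>The weighted arithmetic-geometric mean inequality stands in for Cauchy-Schwarz; the weight
          e is the one for which the bound on G w absorbs half of I.\<close>
      have "0 \<le> (e * ?a - ?b)\<^sup>2 / e" using \<open>e > 0\<close> by simp
      also have "\<dots> = e * ?a\<^sup>2 + ?b\<^sup>2 / e - 2 * (?a * ?b)"
        using \<open>e > 0\<close> by (simp add: power2_eq_square field_simps)
      finally show "norm (f (of_real x + of_real t) * cnj (f (w + of_real t)))
          \<le> (e * ?a\<^sup>2 + ?b\<^sup>2 / e) / 2"
        by (simp add: norm_mult)
    qed (use \<open>e > 0\<close> in \<open>auto intro!: integrable_continuous_interval continuous_intros continuous_on_entire[OF hol]\<close>)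
    also have "\<dots> = (e * integral {-R..R} (\<lambda>t. (norm (f (of_real x + of_real t)))\<^sup>2) + I / e) / 2"
      unfolding I_def
      by (intro integral_unique has_integral_divide has_integral_add has_integral_mult_right
        integrable_integral int_sq)
    also have "integral {-R..R} (\<lambda>t. (norm (f (of_real x + of_real t)))\<^sup>2) \<le> N"
    proof -
      have "integrable lborel (\<lambda>t. (norm (f (of_real x + of_real t)))\<^sup>2)"
        using lborel_integrable_real_affine[OF paley_wiener_square_integrable[OF f], of 1 x] by simp
      then have "integral {-R..R} (\<lambda>t. (norm (f (of_real x + of_real t)))\<^sup>2)
          \<le> (LINT t|lborel. (norm (f (of_real x + of_real t)))\<^sup>2)"
        by (intro integral_interval_le_lborel cont_sq) auto
      also have "\<dots> = N" unfolding N_def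
        using lborel_integral_real_affine[of 1 "\<lambda>t. (norm (f (of_real t)))\<^sup>2" x] by simp
      finally show ?thesis .
    qed
    finally show ?thesis using \<open>e > 0\<close> by (simp add: divide_right_mono)
  qed
  have "G w = of_real I"
    using has_integral_of_real[OF integrable_integral[OF int_sq[of w]], where 'b = complex]
    unfolding G_def I_def by (simp flip: complex_norm_square add: integral_unique)
  then have "I \<le> norm (G w)" by simp
  also have "\<dots> \<le> (e * N + I / e) / 2 * exp (\<sigma> * \<bar>Im w\<bar>)"
  proof (rule phragmen_lindelof_exponential_type)
    show "G holomorphic_on UNIV"
      unfolding G_def[abs_def] by (rule holomorphic_convolution[OF hol cont_h])
    show "exponential_type_le G \<sigma>"
      unfolding G_def[abs_def]
      by (rule exponential_type_le_convolution[OF hol paley_wiener_type[OF f] \<open>\<sigma> \<ge> 0\<close> cont_h \<open>R \<ge> 0\<close>])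
  qed (use G_real \<open>\<sigma> \<ge> 0\<close> in auto)
  also have "\<dots> = (e\<^sup>2 * N + I) / 2"
    using \<open>e > 0\<close> unfolding e_def[symmetric] by (simp add: power2_eq_square field_simps)
  finally have "I \<le> e\<^sup>2 * N" by simp
  also have "e\<^sup>2 = exp (2 * \<sigma> * \<bar>Im w\<bar>)" by (simp add: e_def mult.assoc flip: exp_double)
  finally show ?thesis unfolding I_def N_def .
qed

text \<open>
The estimate on intervals does not depend on their length, so monotone convergence applies.
\<close>

theorem plancherel_polya:
  assumes f: "f \<in> paley_wiener \<sigma>" and "\<sigma> \<ge> 0"
  shows "integrable lborel (\<lambda>t::real. (norm (f (w + of_real t)))\<^sup>2)"
    and "(LINT t|lborel. (norm (f (w + of_real t)))\<^sup>2)
      \<le> exp (2 * \<sigma> * \<bar>Im w\<bar>) * (LINT t|lborel. (norm (f (of_real t)))\<^sup>2)"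
proof -
  have "continuous_on UNIV (\<lambda>t::real. (norm (f (w + of_real t)))\<^sup>2)"
    by (intro continuous_intros continuous_on_entire[OF paley_wiener_holomorphic[OF f]])
  note integrable_if_intervals_bounded[OF this _ plancherel_polya_interval[OF assms]]
  then show "integrable lborel (\<lambda>t::real. (norm (f (w + of_real t)))\<^sup>2)"
    and "(LINT t|lborel. (norm (f (w + of_real t)))\<^sup>2)
      \<le> exp (2 * \<sigma> * \<bar>Im w\<bar>) * (LINT t|lborel. (norm (f (of_real t)))\<^sup>2)" by auto
qed

lemma norm_mult_cnj_le: "norm (x * cnj y) \<le> ((norm x)\<^sup>2 + (norm y)\<^sup>2) / 2"
proof -
  have "0 \<le> (norm x - norm y)\<^sup>2" by simp
  then show ?thesis by (simp add: norm_mult power2_eq_square algebra_simps)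
qed

lemma holomorphic_cnj_cnj:
  assumes "g holomorphic_on UNIV"
  shows "(\<lambda>z. cnj (g (cnj z))) holomorphic_on UNIV"
  using holomorphic_on_compose_cnj_cnj[of g UNIV] assms
  by (simp add: o_def holomorphic_on_subset)

lemma zero_islimpt_Reals: "(0::complex) islimpt \<real>"
  unfolding islimpt_approachable
proof (intro allI impI)
  fix e :: real assume "e > 0"
  then show "\<exists>x\<in>\<real>. x \<noteq> 0 \<and> dist x (0::complex) < e"
    by (intro bexI[of _ "of_real (e / 2)"]) auto
qed

text \<open>
Let \<open>\<Phi> w\<close> be the integral of \<open>F (w + t)\<close> over real \<open>t\<close>, where
\<open>F z = f z * cnj (g (cnj z - cnj b))\<close> is entire. The two sides are \<open>\<Phi> b\<close> and \<open>\<Phi> 0\<close>. Now \<open>\<Phi>\<close> is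
constant on the real axis, because Lebesgue measure is translation invariant, so it is constant as
soon as it is entire. Its truncations to \<open>[-n, n]\<close> are entire, and the Plancherel-Polya inequality
bounds them locally uniformly; by Montel's theorem their pointwise limit \<open>\<Phi>\<close> is entire.
\<close>

lemma paley_wiener_inner_shift:
  assumes f: "f \<in> paley_wiener \<sigma>" and g: "g \<in> paley_wiener \<sigma>" and "\<sigma> \<ge> 0"
  shows "paley_wiener_inner (\<lambda>z. f (z + b)) g = paley_wiener_inner f (\<lambda>z. g (z - cnj b))"
proof -
  define F where "F z = f z * cnj (g (cnj z - cnj b))" for z
  have F_hol: "F holomorphic_on UNIV"
  proof -
    have "(\<lambda>z. cnj (g (cnj z - cnj b))) holomorphic_on UNIV"
      using holomorphic_cnj_cnj[OF entire_affine[OF paley_wiener_holomorphic[OF g], of 1 "- cnj b"]]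
      by simp
    then show ?thesis
      unfolding F_def[abs_def] by (intro holomorphic_intros paley_wiener_holomorphic[OF f])
  qed
  define M where "M w t = ((norm (f (w + of_real t)))\<^sup>2
      + (norm (g (cnj w - cnj b + of_real t)))\<^sup>2) / 2" for w and t :: real
  have F_le_M: "norm (F (w + of_real t)) \<le> M w t" for w t
    using norm_mult_cnj_le[of "f (w + of_real t)" "g (cnj w - cnj b + of_real t)"]
    by (simp add: F_def M_def algebra_simps)
  have M_int: "integrable lborel (M w)" for w
    unfolding M_def[abs_def] using plancherel_polya(1)[OF f \<open>\<sigma> \<ge> 0\<close>] plancherel_polya(1)[OF g \<open>\<sigma> \<ge> 0\<close>]
    by auto
  define \<Phi> where "\<Phi> w = (LINT t|lborel. F (w + of_real t))" for w
  define \<Phi>' where "\<Phi>' n w = integral {- real n..real n} (\<lambda>t. F (w + of_real t))" for n w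
  have cont: "continuous_on S (\<lambda>t. F (w + of_real t))" for w and S :: "real set"
    by (intro continuous_intros continuous_on_entire[OF F_hol])
  note \<Phi>'_eq = integral_interval_eq_indicator[OF cont]
  have \<Phi>'_hol: "\<Phi>' n holomorphic_on UNIV" for n
    using holomorphic_convolution[OF F_hol, of "- real n" "real n" "\<lambda>_. 1"]
    unfolding \<Phi>'_def[abs_def] by simp
  have lim: "(\<lambda>n. \<Phi>' n w) \<longlonglongrightarrow> \<Phi> w" for w
    unfolding \<Phi>'_def \<Phi>'_eq(2) \<Phi>_def
  proof (rule integral_dominated_convergence[OF _ _ M_int[of w]])
    show "AE t in lborel. (\<lambda>n. indicator {- real n..real n} t *\<^sub>R F (w + of_real t)) \<longlonglongrightarrow> F (w + of_real t)"
      by (intro AE_I2 indicator_intervals_tendsto)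
    show "AE t in lborel. norm (indicator {- real n..real n} t *\<^sub>R F (w + of_real t)) \<le> M w t" for n
      using F_le_M order_trans[OF norm_ge_zero F_le_M] by (auto simp: indicator_def)
  qed (use \<Phi>'_eq(1) in \<open>auto simp: borel_measurable_continuous_onI[OF cont]\<close>)
  have bound: "\<exists>B. \<forall>h\<in>range \<Phi>'. \<forall>z\<in>K. norm (h z) \<le> B" if "compact K" for K
  proof -
    obtain r where r: "\<And>z. z \<in> K \<Longrightarrow> norm z \<le> r"
      using compact_imp_bounded[OF \<open>compact K\<close>] by (auto simp: bounded_iff)
    define E where "E = exp (2 * \<sigma> * (r + norm b))"
    define Nf where "Nf = (LINT t|lborel. (norm (f (of_real t)))\<^sup>2)"
    define Ng where "Ng = (LINT t|lborel. (norm (g (of_real t)))\<^sup>2)"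
    have "Nf \<ge> 0" "Ng \<ge> 0" by (auto simp: Nf_def Ng_def)
    have "norm (\<Phi>' n z) \<le> (E * Nf + E * Ng) / 2" if "z \<in> K" for n z
    proof -
      have "norm (\<Phi>' n z) \<le> (LINT t|lborel. M z t)"
        unfolding \<Phi>'_def \<Phi>'_eq(2) using F_le_M order_trans[OF norm_ge_zero F_le_M]
        by (intro Bochner_Integration.integral_norm_bound_integral \<Phi>'_eq(1) M_int) (auto simp: indicator_def)
      also have "\<dots> = ((LINT t|lborel. (norm (f (z + of_real t)))\<^sup>2)
          + (LINT t|lborel. (norm (g (cnj z - cnj b + of_real t)))\<^sup>2)) / 2"
        unfolding M_def using plancherel_polya(1)[OF f \<open>\<sigma> \<ge> 0\<close>] plancherel_polya(1)[OF g \<open>\<sigma> \<ge> 0\<close>]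
        by simp
      also have "\<dots> \<le> (E * Nf + E * Ng) / 2"
      proof -
        have "\<bar>Im z\<bar> \<le> r + norm b" "\<bar>Im (cnj z - cnj b)\<bar> \<le> r + norm b"
          using abs_Im_le_cmod[of z] abs_Im_le_cmod[of b] r[OF \<open>z \<in> K\<close>] norm_ge_zero[of b] by auto
        then have "exp (2 * \<sigma> * \<bar>Im z\<bar>) \<le> E" "exp (2 * \<sigma> * \<bar>Im (cnj z - cnj b)\<bar>) \<le> E"
          using \<open>\<sigma> \<ge> 0\<close> unfolding E_def by (auto intro!: mult_left_mono simp del: minus_complex.sel)
        then have "exp (2 * \<sigma> * \<bar>Im z\<bar>) * Nf \<le> E * Nf" 
            "exp (2 * \<sigma> * \<bar>Im (cnj z - cnj b)\<bar>) * Ng \<le> E * Ng"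
          using \<open>Nf \<ge> 0\<close> \<open>Ng \<ge> 0\<close> by (auto intro: mult_right_mono)
        note le_Nf = order_trans[OF plancherel_polya(2)[OF f \<open>\<sigma> \<ge> 0\<close>, folded Nf_def] this(1)]
          and le_Ng = order_trans[OF plancherel_polya(2)[OF g \<open>\<sigma> \<ge> 0\<close>, folded Ng_def] this(2)]
        then show ?thesis by (intro divide_right_mono add_mono le_Nf le_Ng) auto
      qed
      finally show ?thesis .
    qed
    then show ?thesis by blast
  qed
  obtain \<Psi> r where \<Psi>: "\<Psi> holomorphic_on UNIV" and r: "strict_mono (r :: nat \<Rightarrow> nat)"
    and sub: "\<And>z. (\<lambda>n. \<Phi>' (r n) z) \<longlonglongrightarrow> \<Psi> z"
  proof (rule Montel[of UNIV "range \<Phi>'" \<Phi>'])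
    show "h holomorphic_on UNIV" if "h \<in> range \<Phi>'" for h using that \<Phi>'_hol by blast
    show "\<exists>B. \<forall>h\<in>range \<Phi>'. \<forall>z\<in>K. norm (h z) \<le> B" if "compact K" for K by (rule bound[OF that])
  qed (use that in auto)
  have "\<Psi> z = \<Phi> z" for z
    using LIMSEQ_unique[OF sub LIMSEQ_subseq_LIMSEQ[OF lim r, unfolded o_def]] .
  then have "\<Psi> = \<Phi>" by (rule ext)
  with \<Psi> have \<Phi>_hol: "\<Phi> holomorphic_on UNIV" by simp
  have real: "\<Phi> (of_real x) = \<Phi> 0" for x
    unfolding \<Phi>_def using lborel_integral_real_affine[of 1 "\<lambda>t. F (of_real t)" x] by simp
  have "\<Phi> b - \<Phi> 0 = 0"
  proof (rule analytic_continuation[of "\<lambda>z. \<Phi> z - \<Phi> 0" UNIV \<real> 0 b])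
    show "(\<lambda>z. \<Phi> z - \<Phi> 0) holomorphic_on UNIV" by (intro holomorphic_on_diff \<Phi>_hol holomorphic_on_const)
    show "\<Phi> z - \<Phi> 0 = 0" if "z \<in> \<real>" for z
      using that real by (metis Reals_cases right_minus_eq)
  qed (simp_all add: zero_islimpt_Reals connected_UNIV)
  then have "\<Phi> b = \<Phi> 0" by simp
  then show ?thesis
    by (simp add: \<Phi>_def F_def paley_wiener_inner_def add.commute)
qed

section \<open>Composition operators on the Paley-Wiener space\<close>

lemma paley_wiener_affine:
  assumes f: "f \<in> paley_wiener \<sigma>" and "\<sigma> \<ge> 0" and a: "a = 1 \<or> a = -1"
  shows "(\<lambda>z. f (a * z + b)) \<in> paley_wiener \<sigma>"
    and "(LINT t|lborel. (norm (f (a * of_real t + b)))\<^sup>2)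
      \<le> exp (2 * \<sigma> * \<bar>Im b\<bar>) * (LINT t|lborel. (norm (f (of_real t)))\<^sup>2)"
proof -
  have "norm a = 1" using a by auto
  obtain s :: real where s: "a = of_real s" "\<bar>s\<bar> = 1" using a by (metis abs_minus abs_one of_real_1 of_real_minus)
  let ?h = "\<lambda>t. (norm (f (b + of_real t)))\<^sup>2"
  have eq: "(norm (f (a * of_real t + b)))\<^sup>2 = ?h (0 + s * t)" for t
    by (simp add: s add.commute)
  have int: "integrable lborel (\<lambda>t. (norm (f (a * of_real t + b)))\<^sup>2)"
    unfolding eq using s by (intro lborel_integrable_real_affine plancherel_polya(1)[OF f \<open>\<sigma> \<ge> 0\<close>]) auto
  then show "(\<lambda>z. f (a * z + b)) \<in> paley_wiener \<sigma>"
    using entire_affine[OF paley_wiener_holomorphic[OF f]]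
      exponential_type_le_affine[OF paley_wiener_type[OF f] \<open>norm a = 1\<close> \<open>\<sigma> \<ge> 0\<close>]
    by (simp add: paley_wiener_def)
  have "(LINT t|lborel. (norm (f (a * of_real t + b)))\<^sup>2) = (LINT t|lborel. ?h t)"
    unfolding eq using lborel_integral_real_affine[of s ?h 0] s by auto
  then show "(LINT t|lborel. (norm (f (a * of_real t + b)))\<^sup>2)
      \<le> exp (2 * \<sigma> * \<bar>Im b\<bar>) * (LINT t|lborel. (norm (f (of_real t)))\<^sup>2)"
    using plancherel_polya(2)[OF f \<open>\<sigma> \<ge> 0\<close>, of b] by simp
qed

lemma paley_wiener_inner_reflect:
  "paley_wiener_inner (\<lambda>z. f (- z)) (\<lambda>z. g (- z)) = paley_wiener_inner f g"
  unfolding paley_wiener_inner_def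
  using lborel_integral_real_affine[of "-1" "\<lambda>t. f (of_real t) * cnj (g (of_real t))" 0] by simp

lemma paley_wiener_inner_affine:
  assumes f: "f \<in> paley_wiener \<sigma>" and g: "g \<in> paley_wiener \<sigma>" and "\<sigma> \<ge> 0"
    and a: "a = 1 \<or> a = -1"
  shows "paley_wiener_inner (\<lambda>z. f (a * z + b)) g = paley_wiener_inner f (\<lambda>z. g (a * z - a * cnj b))"
  using a
proof
  assume "a = -1"
  have g': "(\<lambda>z. g (- z)) \<in> paley_wiener \<sigma>"
    using paley_wiener_affine(1)[OF g \<open>\<sigma> \<ge> 0\<close>, of "-1" 0] by simp
  have "paley_wiener_inner (\<lambda>z. f (- z + b)) g = paley_wiener_inner (\<lambda>z. f (z + b)) (\<lambda>z. g (- z))"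
    using paley_wiener_inner_reflect[of "\<lambda>z. f (z + b)" "\<lambda>z. g (- z)"] by simp
  also have "\<dots> = paley_wiener_inner f (\<lambda>z. g (- (z - cnj b)))"
    by (rule paley_wiener_inner_shift[OF f g' \<open>\<sigma> \<ge> 0\<close>])
  finally show ?thesis using \<open>a = -1\<close> by (simp add: algebra_simps)
qed (use paley_wiener_inner_shift[OF f g \<open>\<sigma> \<ge> 0\<close>] in simp)

lemma paley_wiener_diff:
  assumes f: "f \<in> paley_wiener \<sigma>" and g: "g \<in> paley_wiener \<sigma>"
  shows "(\<lambda>z. f z - g z) \<in> paley_wiener \<sigma>"
proof -
  have hol: "(\<lambda>z. f z - g z) holomorphic_on UNIV"
    by (intro holomorphic_intros paley_wiener_holomorphic[OF f] paley_wiener_holomorphic[OF g])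
  moreover have "exponential_type_le (\<lambda>z. f z - g z) \<sigma>"
    unfolding exponential_type_le_def
  proof (intro allI impI)
    fix \<epsilon> :: real assume "\<epsilon> > 0"
    then obtain C D where "\<And>z. norm (f z) \<le> C * exp ((\<sigma> + \<epsilon>) * norm z)"
        "\<And>z. norm (g z) \<le> D * exp ((\<sigma> + \<epsilon>) * norm z)"
      using paley_wiener_type[OF f] paley_wiener_type[OF g] unfolding exponential_type_le_def by metis
    then have "norm (f z - g z) \<le> (C + D) * exp ((\<sigma> + \<epsilon>) * norm z)" for z
      unfolding distrib_right by (rule norm_triangle_le_diff[OF add_mono])
    then show "\<exists>C. \<forall>z. norm (f z - g z) \<le> C * exp ((\<sigma> + \<epsilon>) * norm z)" by blast
  qed
  moreover have "integrable lborel (\<lambda>t::real. (norm (f (of_real t) - g (of_real t)))\<^sup>2)"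
  proof (rule Bochner_Integration.integrable_bound)
    show "integrable lborel (\<lambda>t::real. 2 * (norm (f (of_real t)))\<^sup>2 + 2 * (norm (g (of_real t)))\<^sup>2)"
      using paley_wiener_square_integrable[OF f] paley_wiener_square_integrable[OF g] by simp
    have "continuous_on UNIV (\<lambda>t::real. (norm (f (of_real t) - g (of_real t)))\<^sup>2)"
      by (intro continuous_intros continuous_on_entire[OF hol])
    then show "(\<lambda>t::real. (norm (f (of_real t) - g (of_real t)))\<^sup>2) \<in> borel_measurable lborel"
      by (simp add: borel_measurable_continuous_onI)
    have "(norm (x - y))\<^sup>2 \<le> 2 * (norm x)\<^sup>2 + 2 * (norm y)\<^sup>2" for x y :: complex
    proof -
      have "(norm (x - y))\<^sup>2 \<le> (norm x + norm y)\<^sup>2"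
        by (intro power_mono norm_triangle_ineq4) simp
      also have "\<dots> \<le> 2 * (norm x)\<^sup>2 + 2 * (norm y)\<^sup>2"
        using zero_le_power2[of "norm x - norm y"] by (simp add: power2_eq_square algebra_simps)
      finally show ?thesis .
    qed
    then show "AE t::real in lborel. norm ((norm (f (of_real t) - g (of_real t)))\<^sup>2)
        \<le> norm (2 * (norm (f (of_real t)))\<^sup>2 + 2 * (norm (g (of_real t)))\<^sup>2)"
      by (simp add: add_nonneg_nonneg)
  qed
  ultimately show ?thesis by (simp add: paley_wiener_def)
qed

lemma paley_wiener_inner_self:
  "paley_wiener_inner f f = of_real (LINT t|lborel. (norm (f (of_real t)))\<^sup>2)"
  unfolding paley_wiener_inner_def by (simp flip: complex_norm_square integral_complex_of_real)

lemma integrable_paley_wiener_inner: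
  assumes f: "f \<in> paley_wiener \<sigma>" and g: "g \<in> paley_wiener \<sigma>"
  shows "integrable lborel (\<lambda>t::real. f (of_real t) * cnj (g (of_real t)))"
proof (rule Bochner_Integration.integrable_bound)
  show "integrable lborel (\<lambda>t::real. ((norm (f (of_real t)))\<^sup>2 + (norm (g (of_real t)))\<^sup>2) / 2)"
    using paley_wiener_square_integrable[OF f] paley_wiener_square_integrable[OF g] by simp
  have "continuous_on UNIV (\<lambda>t::real. f (of_real t) * cnj (g (of_real t)))"
    by (intro continuous_intros continuous_on_entire[OF paley_wiener_holomorphic[OF f]]
        continuous_on_entire[OF paley_wiener_holomorphic[OF g]])
  then show "(\<lambda>t::real. f (of_real t) * cnj (g (of_real t))) \<in> borel_measurable lborel"
    by (simp add: borel_measurable_continuous_onI)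
  show "AE t::real in lborel. norm (f (of_real t) * cnj (g (of_real t)))
      \<le> norm (((norm (f (of_real t)))\<^sup>2 + (norm (g (of_real t)))\<^sup>2) / 2)"
    using norm_mult_cnj_le by (simp add: add_nonneg_nonneg)
qed

text \<open>
The Plancherel-Polya inequality makes the integrals of \<open>(norm f)\<^sup>2\<close> along all horizontal lines
vanish with the one along the real axis, so continuity alone gives \<open>f = 0\<close> on the whole plane.
\<close>

lemma paley_wiener_inner_definite:
  assumes f: "f \<in> paley_wiener \<sigma>" and "\<sigma> \<ge> 0" and "paley_wiener_inner f f = 0"
  shows "f = (\<lambda>_. 0)"
proof
  fix w
  let ?g = "\<lambda>t. (norm (f (w + of_real t)))\<^sup>2"
  have "continuous_on {-1..1} ?g"
    by (intro continuous_intros continuous_on_entire[OF paley_wiener_holomorphic[OF f]])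
  moreover have "integral {-1..1} ?g = 0"
  proof (rule antisym)
    show "integral {-1..1} ?g \<le> 0"
      using plancherel_polya_interval[OF f \<open>\<sigma> \<ge> 0\<close>, of 1 w] assms(3)
      by (simp add: paley_wiener_inner_self)
    show "integral {-1..1} ?g \<ge> 0"
      using calculation by (intro integral_nonneg integrable_continuous_interval) auto
  qed
  ultimately have "\<forall>t\<in>{-1..1}. ?g t = 0"
    by (subst (asm) integral_eq_0_iff) auto
  from bspec[OF this, of 0] show "f w = 0" by simp
qed

lemma paley_wiener_adjoint_unique:
  assumes "\<sigma> \<ge> 0" and h: "h \<in> paley_wiener \<sigma>" and k: "k \<in> paley_wiener \<sigma>"
    and eq: "\<And>f. f \<in> paley_wiener \<sigma> \<Longrightarrow> paley_wiener_inner f h = paley_wiener_inner f k"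
  shows "h = k"
proof -
  define d where "d z = h z - k z" for z
  have d: "d \<in> paley_wiener \<sigma>"
    unfolding d_def[abs_def] by (rule paley_wiener_diff[OF h k])
  have "paley_wiener_inner d d = paley_wiener_inner d h - paley_wiener_inner d k"
    unfolding paley_wiener_inner_def
    using Bochner_Integration.integral_diff
      [OF integrable_paley_wiener_inner[OF d h] integrable_paley_wiener_inner[OF d k]]
    by (simp add: d_def right_diff_distrib)
  then have "paley_wiener_inner d d = 0" using eq[OF d] by simp
  then have "d = (\<lambda>_. 0)" using paley_wiener_inner_definite[OF d \<open>\<sigma> \<ge> 0\<close>] by blast
  then show ?thesis by (auto simp: d_def fun_eq_iff)
qed

text \<open>
The adjoint is again a composition operator, with symbol \<open>a * z - a * cnj b\<close>. All the operator
identities of the theorem thereby become identities between symbols.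
\<close>

lemma adjoint_composition_affine:
  assumes g: "g \<in> paley_wiener \<sigma>" and "\<sigma> \<ge> 0" and a: "a = 1 \<or> a = -1"
  shows "adjoint_on (paley_wiener \<sigma>) paley_wiener_inner (composition_operator (\<lambda>z. a * z + b)) g
    = (\<lambda>z. g (a * z - a * cnj b))"
  unfolding adjoint_on_def
proof (rule the_equality)
  let ?h = "\<lambda>z. g (a * z - a * cnj b)"
  have h: "?h \<in> paley_wiener \<sigma>"
    using paley_wiener_affine(1)[OF g \<open>\<sigma> \<ge> 0\<close> a, of "- a * cnj b"] by simp
  have adj: "paley_wiener_inner (composition_operator (\<lambda>z. a * z + b) f) g = paley_wiener_inner f ?h"
    if "f \<in> paley_wiener \<sigma>" for f
    using paley_wiener_inner_affine[OF that g \<open>\<sigma> \<ge> 0\<close> a]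
    by (simp add: composition_operator_def o_def)
  show "?h \<in> paley_wiener \<sigma> \<and> (\<forall>f\<in>paley_wiener \<sigma>.
      paley_wiener_inner (composition_operator (\<lambda>z. a * z + b) f) g = paley_wiener_inner f ?h)"
    using h adj by blast
  fix k assume "k \<in> paley_wiener \<sigma> \<and> (\<forall>f\<in>paley_wiener \<sigma>.
      paley_wiener_inner (composition_operator (\<lambda>z. a * z + b) f) g = paley_wiener_inner f k)"
  then show "k = ?h" using paley_wiener_adjoint_unique[OF \<open>\<sigma> \<ge> 0\<close> _ h] adj by auto
qed

lemma bounded_composition_affine:
  assumes "\<sigma> \<ge> 0" and a: "a = 1 \<or> a = -1"
  shows "bounded_operator_on (paley_wiener \<sigma>) paley_wiener_inner (composition_operator (\<lambda>z. a * z + b))"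
  unfolding bounded_operator_on_def composition_operator_def o_def norm_on_def paley_wiener_inner_self
proof (intro conjI ballI allI exI)
  fix f assume f: "f \<in> paley_wiener \<sigma>"
  show "(\<lambda>z. f (a * z + b)) \<in> paley_wiener \<sigma>"
    by (rule paley_wiener_affine(1)[OF f assms])
  show "sqrt (Re (of_real (LINT t|lborel. (norm (f (a * of_real t + b)))\<^sup>2)))
      \<le> sqrt (exp (2 * \<sigma> * \<bar>Im b\<bar>)) * sqrt (Re (of_real (LINT t|lborel. (norm (f (of_real t)))\<^sup>2)))"
    using paley_wiener_affine(2)[OF f assms] by (simp flip: real_sqrt_mult)
qed auto

text \<open>
Up to the factor \<open>1 / pi\<close>, the reproducing kernel of the Paley-Wiener space at the origin.
\<close>

definition sinc_kernel :: "real \<Rightarrow> complex \<Rightarrow> complex"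
  where "sinc_kernel \<sigma> z = (if z = 0 then of_real \<sigma> else sin (of_real \<sigma> * z) / z)"

lemma sinc_kernel_in_paley_wiener:
  assumes "\<sigma> > 0"
  shows "sinc_kernel \<sigma> \<in> paley_wiener \<sigma>"
proof -
  let ?g = "sinc_kernel \<sigma>"
  have hol: "?g holomorphic_on UNIV"
  proof (rule pole_theorem_0)
    show "(\<lambda>z. sin (of_real \<sigma> * z)) holomorphic_on UNIV" by (intro holomorphic_intros)
    show "?g 0 = deriv (\<lambda>z. sin (of_real \<sigma> * z)) 0"
      by (rule DERIV_imp_deriv[symmetric]) (auto simp: sinc_kernel_def intro!: derivative_eq_intros)
  qed (auto simp: sinc_kernel_def)
  \<comment> \<open>Near the origin, where the quotient gives no estimate, compactness bounds the function by H.\<close>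
  have "bounded (?g ` cball 0 1)"
    by (intro compact_imp_bounded compact_continuous_image continuous_on_entire[OF hol, of _ "\<lambda>z. z"]) auto
  then obtain H where "\<forall>z\<in>cball 0 1. norm (?g z) \<le> H" by (auto simp: bounded_iff)
  then have H: "norm (?g z) \<le> H" if "norm z \<le> 1" for z
    using that by simp
  have "H \<ge> 0" using order_trans[OF norm_ge_zero H[of 0]] by simp
  have "exponential_type_le ?g \<sigma>"
    unfolding exponential_type_le_def
  proof (intro allI impI exI)
    fix \<epsilon> :: real and z :: complex assume "\<epsilon> > 0"
    show "norm (?g z) \<le> (H + 1) * exp ((\<sigma> + \<epsilon>) * norm z)"
    proof (cases "norm z \<le> 1")
      case True
      have "norm (?g z) \<le> (H + 1) * 1" using H[OF True] by simp
      also have "\<dots> \<le> (H + 1) * exp ((\<sigma> + \<epsilon>) * norm z)"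
        using \<open>H \<ge> 0\<close> \<open>\<epsilon> > 0\<close> \<open>\<sigma> > 0\<close> by (intro mult_left_mono) auto
      finally show ?thesis .
    next
      case False
      then have "norm (?g z) \<le> norm (sin (of_real \<sigma> * z))"
        by (auto simp: sinc_kernel_def norm_divide divide_le_eq mult_le_cancel_left1)
      also have "\<dots> \<le> exp \<bar>Im (of_real \<sigma> * z)\<bar>"
        using cmod_sin_le_exp[of 1 "of_real \<sigma> * z"] by simp
      also have "\<dots> \<le> 1 * exp ((\<sigma> + \<epsilon>) * norm z)"
        using \<open>\<epsilon> > 0\<close> \<open>\<sigma> > 0\<close> abs_Im_le_cmod[of z] by (auto simp: abs_mult intro!: mult_mono)
      also have "\<dots> \<le> (H + 1) * exp ((\<sigma> + \<epsilon>) * norm z)"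
        using \<open>H \<ge> 0\<close> by (intro mult_right_mono) auto
      finally show ?thesis .
    qed
  qed
  moreover have "integrable lborel (\<lambda>t::real. (norm (?g (of_real t)))\<^sup>2)"
  proof (rule Bochner_Integration.integrable_bound)
    show "integrable lborel (\<lambda>t::real. 2 * (H\<^sup>2 + 1) * inverse (1 + t\<^sup>2))"
      using integrable_inverse_1_plus_square
      by (simp add: einterval_eq_UNIV set_integrable_def)
    have "continuous_on UNIV (\<lambda>t::real. (norm (?g (of_real t)))\<^sup>2)"
      by (intro continuous_intros continuous_on_entire[OF hol])
    then show "(\<lambda>t::real. (norm (?g (of_real t)))\<^sup>2) \<in> borel_measurable lborel"
      by (simp add: borel_measurable_continuous_onI)
    have "(norm (?g (of_real t)))\<^sup>2 \<le> 2 * (H\<^sup>2 + 1) * inverse (1 + t\<^sup>2)" for t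
    proof (cases "\<bar>t\<bar> \<le> 1")
      case True
      then have "(norm (?g (of_real t)))\<^sup>2 \<le> H\<^sup>2"
        using H[of "of_real t"] by (intro power_mono) auto
      moreover have "t\<^sup>2 \<le> 1" using True by (simp add: abs_square_le_1)
      then have "H\<^sup>2 * (1 + t\<^sup>2) \<le> H\<^sup>2 * 2" by (intro mult_left_mono) auto
      then have "H\<^sup>2 \<le> 2 * (H\<^sup>2 + 1) * inverse (1 + t\<^sup>2)"
        by (simp add: field_simps add_pos_nonneg)
      ultimately show ?thesis by linarith
    next
      case False
      then have "t \<noteq> 0" "1 \<le> t\<^sup>2" by (auto simp: abs_square_le_1[symmetric])
      have "(norm (sin (of_real \<sigma> * of_real t :: complex)))\<^sup>2 \<le> 1"
        by (metis abs_sin_le_one norm_ge_zero norm_of_real of_real_mult power_le_one sin_of_real)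
      then have "(norm (?g (of_real t)))\<^sup>2 \<le> 1 / t\<^sup>2"
        using \<open>t \<noteq> 0\<close> by (simp add: sinc_kernel_def norm_divide power_divide divide_right_mono)
      also have "\<dots> \<le> 2 * inverse (1 + t\<^sup>2)"
      proof -
        have "1 / t\<^sup>2 = 2 / (2 * t\<^sup>2)" by simp
        also have "\<dots> \<le> 2 / (1 + t\<^sup>2)" 
          using \<open>1 \<le> t\<^sup>2\<close> \<open>t \<noteq> 0\<close> by (intro divide_left_mono mult_pos_pos add_pos_nonneg) auto
        finally show ?thesis by (simp add: divide_inverse)
      qed
      also have "\<dots> \<le> 2 * (H\<^sup>2 + 1) * inverse (1 + t\<^sup>2)"
        by (intro mult_right_mono) (auto intro: add_nonneg_nonneg)
      finally show ?thesis .
    qed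
    then show "AE t::real in lborel. norm ((norm (?g (of_real t)))\<^sup>2)
        \<le> norm (2 * (H\<^sup>2 + 1) * inverse (1 + t\<^sup>2))"
      by (intro AE_I2) (smt (verit) real_norm_def zero_le_power2)
  qed
  ultimately show ?thesis using hol by (simp add: paley_wiener_def)
qed

text \<open>
The difference \<open>c\<close> of two translations that agree is a period of \<open>sin (\<sigma> * z) / z\<close>. Shifting the zero at
\<open>pi / \<sigma>\<close> by \<open>c\<close> shows that \<open>sin (\<sigma> * c) = 0\<close>. If \<open>c\<close> were not zero, the function would vanish
at \<open>c\<close>, although it takes the value \<open>\<sigma>\<close> at 0.
\<close>

lemma translations_eq_on_paley_wiener:
  assumes "\<sigma> > 0" and eq: "\<And>f z. f \<in> paley_wiener \<sigma> \<Longrightarrow> f (z + p) = f (z + q)"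
  shows "p = q"
proof (rule ccontr)
  assume "p \<noteq> q"
  define c where "c = p - q"
  define g where "g = sinc_kernel \<sigma>"
  note g_eq = fun_cong[OF g_def, unfolded sinc_kernel_def]
  have "g \<in> paley_wiener \<sigma>"
    unfolding g_def by (rule sinc_kernel_in_paley_wiener[OF \<open>\<sigma> > 0\<close>])
  then have period: "g (z + c) = g z" for z
    using eq[of g "z - q"] by (simp add: c_def algebra_simps)
  have "c \<noteq> 0" using \<open>p \<noteq> q\<close> by (simp add: c_def)
  let ?t = "of_real (pi / \<sigma>) :: complex"
  have "?t \<noteq> 0" "of_real \<sigma> * ?t = of_real pi" using \<open>\<sigma> > 0\<close> by auto
  then have "g ?t = 0" by (simp add: g_eq flip: sin_of_real)
  then have "g (?t + c) = 0" using period by simp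
  then have "?t + c \<noteq> 0" "sin (of_real \<sigma> * (?t + c)) = 0"
    using \<open>\<sigma> > 0\<close> by (auto simp: g_eq split: if_splits)
  then have "sin (of_real pi + of_real \<sigma> * c) = 0"
    using \<open>of_real \<sigma> * ?t = of_real pi\<close> by (simp add: distrib_left)
  then have "sin (of_real \<sigma> * c) = 0" by (simp add: sin_add flip: sin_of_real cos_of_real)
  then have "g c = 0" using \<open>c \<noteq> 0\<close> by (simp add: g_eq)
  then show False using period[of 0] \<open>\<sigma> > 0\<close> by (simp add: g_eq)
qed

lemma conjugation_paley_wiener_conj:
  assumes "\<sigma> \<ge> 0" and a: "a = 1 \<or> a = -1"
  shows "conjugation_on (paley_wiener \<sigma>) paley_wiener_inner (paley_wiener_conj a)"
  unfolding conjugation_on_def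
proof (intro conjI ballI allI)
  fix f assume f: "f \<in> paley_wiener \<sigma>"
  have fa: "(\<lambda>z. f (- a * z)) \<in> paley_wiener \<sigma>"
    using paley_wiener_affine(1)[OF f \<open>\<sigma> \<ge> 0\<close>, of "- a" 0] a by auto
  have "exponential_type_le (\<lambda>z. cnj (f (- a * cnj z))) \<sigma>"
    unfolding exponential_type_le_def
  proof (intro allI impI)
    fix \<epsilon> :: real assume "\<epsilon> > 0"
    then obtain C where C: "\<And>z. norm (f (- a * z)) \<le> C * exp ((\<sigma> + \<epsilon>) * norm z)"
      using paley_wiener_type[OF fa] unfolding exponential_type_le_def by blast
    have "norm (cnj (f (- a * cnj z))) \<le> C * exp ((\<sigma> + \<epsilon>) * norm z)" for z
      using C[of "cnj z"] by simp
    then show "\<exists>C. \<forall>z. norm (cnj (f (- a * cnj z))) \<le> C * exp ((\<sigma> + \<epsilon>) * norm z)" by blast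
  qed
  then show "paley_wiener_conj a f \<in> paley_wiener \<sigma>"
    using holomorphic_cnj_cnj[OF paley_wiener_holomorphic[OF fa]] paley_wiener_square_integrable[OF fa]
    by (simp add: paley_wiener_def paley_wiener_conj_def)
  show "paley_wiener_conj a (paley_wiener_conj a f) = f"
    using a by (auto simp: paley_wiener_conj_def)
  fix g
  have "paley_wiener_inner (paley_wiener_conj a f) (paley_wiener_conj a g)
      = paley_wiener_inner (\<lambda>z. g (- a * z)) (\<lambda>z. f (- a * z))"
    by (simp add: paley_wiener_inner_def paley_wiener_conj_def mult.commute)
  also have "\<dots> = paley_wiener_inner g f"
    using a paley_wiener_inner_reflect[of g f] by auto
  finally show "paley_wiener_inner (paley_wiener_conj a f) (paley_wiener_conj a g) = paley_wiener_inner g f" .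
qed (simp add: paley_wiener_conj_def)

lemma paley_wiener_conj_symmetric:
  assumes "\<sigma> \<ge> 0" and a: "a = 1 \<or> a = -1"
  shows "J_symmetric_on (paley_wiener \<sigma>) paley_wiener_inner (paley_wiener_conj a)
      (composition_operator (\<lambda>z. a * z + b))"
  unfolding J_symmetric_on_def
proof (intro conjI ballI bounded_composition_affine[OF assms])
  fix f assume f: "f \<in> paley_wiener \<sigma>"
  have "paley_wiener_conj a f \<in> paley_wiener \<sigma>"
    using conjugation_paley_wiener_conj[OF assms] f by (simp add: conjugation_on_def)
  then have "adjoint_on (paley_wiener \<sigma>) paley_wiener_inner (composition_operator (\<lambda>z. a * z + b))
      (paley_wiener_conj a f) = (\<lambda>z. paley_wiener_conj a f (a * z - a * cnj b))"
    using assms by (rule adjoint_composition_affine)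
  also have "\<dots> = paley_wiener_conj a (composition_operator (\<lambda>z. a * z + b) f)"
    using a by (auto simp: paley_wiener_conj_def composition_operator_def algebra_simps)
  finally show "paley_wiener_conj a (composition_operator (\<lambda>z. a * z + b) f)
    = adjoint_on (paley_wiener \<sigma>) paley_wiener_inner (composition_operator (\<lambda>z. a * z + b))
        (paley_wiener_conj a f)" ..
qed

text \<open>
Since \<open>a * a = 1\<close>, both products of the operator with its adjoint are translations, and for
self-adjointness two symbols with the same linear part are compared. As distinct translations are
told apart by the Paley-Wiener space, normality says \<open>a * (b - cnj b) = b - cnj b\<close>, self-adjointness
\<open>- a * cnj b = b\<close>, and unitarity \<open>b = cnj b\<close>.
\<close>

theorem proposition3p2:
  fixes \<sigma> :: real and a b :: complex and \<phi> :: "complex \<Rightarrow> complex"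
  assumes "\<sigma> > 0"
    and "a = 1 \<or> a = -1"
    and "\<phi> = (\<lambda>z. a * z + b)"
  shows "complex_symmetric_on (paley_wiener \<sigma>) paley_wiener_inner (composition_operator \<phi>) \<and>
    (normal_on (paley_wiener \<sigma>) paley_wiener_inner (composition_operator \<phi>)
       \<longleftrightarrow> a = 1 \<or> (a = -1 \<and> b \<in> \<real>)) \<and>
    (self_adjoint_on (paley_wiener \<sigma>) paley_wiener_inner (composition_operator \<phi>)
       \<longleftrightarrow> (a = 1 \<and> b \<in> (\<lambda>r. \<i> * r) ` \<real>) \<or> (a = -1 \<and> b \<in> \<real>)) \<and>
    (unitary_on (paley_wiener \<sigma>) paley_wiener_inner (composition_operator \<phi>) \<longleftrightarrow> b \<in> \<real>) \<and>
    conjugation_on (paley_wiener \<sigma>) paley_wiener_inner (paley_wiener_conj a) \<and>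
    J_symmetric_on (paley_wiener \<sigma>) paley_wiener_inner (paley_wiener_conj a)
      (composition_operator \<phi>)"
proof -
  have "\<sigma> \<ge> 0" using assms(1) by simp
  note a = assms(2)
  have aa: "a * a = 1" "a * (a * z) = z" for z using a by auto
  define H where "H = paley_wiener \<sigma>"
  let ?T = "composition_operator \<phi>"
  let ?A = "adjoint_on H paley_wiener_inner ?T"
  have T: "?T f = (\<lambda>z. f (a * z + b))" for f
    by (simp add: composition_operator_def o_def assms(3))
  have A: "?A f = (\<lambda>z. f (a * z - a * cnj b))" if "f \<in> H" for f
    using adjoint_composition_affine[OF that[unfolded H_def] \<open>\<sigma> \<ge> 0\<close> a] by (simp add: H_def assms(3))
  have bounded: "bounded_operator_on H paley_wiener_inner ?T"
    using bounded_composition_affine[OF \<open>\<sigma> \<ge> 0\<close> a] by (simp add: H_def assms(3))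
  then have T_in: "?T f \<in> H" if "f \<in> H" for f
    using that by (simp add: bounded_operator_on_def)
  have TA: "?T (?A f) = (\<lambda>z. f (z + a * (b - cnj b)))" if "f \<in> H" for f
    using A[OF that] by (simp add: T algebra_simps aa)
  have AT: "?A (?T f) = (\<lambda>z. f (z + (b - cnj b)))" if "f \<in> H" for f
    using A[OF T_in[OF that]] by (simp add: T algebra_simps aa)
  have shifts: "(\<forall>f\<in>H. (\<lambda>z. f (z + p)) = (\<lambda>z. f (z + q))) \<longleftrightarrow> p = q" for p q
  proof
    assume "\<forall>f\<in>H. (\<lambda>z. f (z + p)) = (\<lambda>z. f (z + q))"
    then have "f (z + p) = f (z + q)" if "f \<in> H" for f z
      using that by meson
    then show "p = q"
      by (rule translations_eq_on_paley_wiener[OF \<open>\<sigma> > 0\<close>]) (simp add: H_def)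
  qed simp
  have real: "b \<in> \<real> \<longleftrightarrow> b - cnj b = 0" by (auto simp: complex_is_Real_iff complex_eq_iff)
  have normal: "normal_on H paley_wiener_inner ?T \<longleftrightarrow> a * (b - cnj b) = b - cnj b"
    using bounded TA AT shifts[of "a * (b - cnj b)" "b - cnj b"] by (simp add: normal_on_def)
  have self_adjoint: "self_adjoint_on H paley_wiener_inner ?T \<longleftrightarrow> - a * cnj b = b"
  proof -
    have "(?A f = ?T f) \<longleftrightarrow> (\<lambda>z. f (z + (- a * cnj b))) = (\<lambda>z. f (z + b))" if "f \<in> H" for f
      unfolding A[OF that] T fun_eq_iff using aa by (metis add.commute mult_minus_left uminus_add_conv_diff)
    then show ?thesis using bounded shifts[of "- a * cnj b" b] by (simp add: self_adjoint_on_def)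
  qed
  have unitary: "unitary_on H paley_wiener_inner ?T \<longleftrightarrow> b - cnj b = 0"
  proof -
    have "unitary_on H paley_wiener_inner ?T \<longleftrightarrow> (\<forall>f\<in>H. (\<lambda>z. f (z + a * (b - cnj b))) = (\<lambda>z. f (z + 0)))
        \<and> (\<forall>f\<in>H. (\<lambda>z. f (z + (b - cnj b))) = (\<lambda>z. f (z + 0)))"
      using bounded TA AT by (auto simp: unitary_on_def)
    then show ?thesis unfolding shifts using a by auto
  qed
  have "- cnj b = b \<longleftrightarrow> b \<in> (\<lambda>r. \<i> * r) ` \<real>"
  proof
    assume "- cnj b = b"
    then have "b = \<i> * of_real (Im b)" by (auto simp: complex_eq_iff)
    then show "b \<in> (\<lambda>r. \<i> * r) ` \<real>" by (rule image_eqI) simp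
  qed (auto simp: complex_is_Real_iff complex_eq_iff)
  then have self_adjoint': "self_adjoint_on H paley_wiener_inner ?T
      \<longleftrightarrow> (a = 1 \<and> b \<in> (\<lambda>r. \<i> * r) ` \<real>) \<or> (a = -1 \<and> b \<in> \<real>)"
    unfolding self_adjoint Reals_cnj_iff using a by auto
  have normal': "normal_on H paley_wiener_inner ?T \<longleftrightarrow> a = 1 \<or> (a = -1 \<and> b \<in> \<real>)"
    unfolding normal real using a by (elim disjE) (simp_all add: complex_eq_iff)
  have conj: "conjugation_on H paley_wiener_inner (paley_wiener_conj a)"
    unfolding H_def by (rule conjugation_paley_wiener_conj[OF \<open>\<sigma> \<ge> 0\<close> a])
  have sym: "J_symmetric_on H paley_wiener_inner (paley_wiener_conj a) ?T"
    unfolding H_def assms(3) by (rule paley_wiener_conj_symmetric[OF \<open>\<sigma> \<ge> 0\<close> a])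
  have "complex_symmetric_on H paley_wiener_inner ?T"
    unfolding complex_symmetric_on_def using conj sym by blast
  then show ?thesis
    using normal' self_adjoint' unitary[folded real] conj sym unfolding H_def by (intro conjI)
qed

end
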